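(* Let $p$ be an odd prime, $\alpha\in\mathbb Z_p$ and $z\in\mathbb Z_p^\times$ such that $z-1$ is prime to $p$. Then $$ {}_2F_1\bigg[\begin{matrix}\alpha&\alpha\\&1\end{matrix}\bigg|\,z\bigg]_{p-1}-z^{1-\lambda_p(\alpha)}{}_2F_1\bigg[\begin{matrix}\alpha&\alpha\\&1\end{matrix}\bigg|\,\frac1z\bigg]_{p-1}\equiv(1-z)^{1-\lambda_p(\alpha)}{}_2F_1\bigg[\begin{matrix}\alpha&1-\alpha\\&1\end{matrix}\bigg|\,\frac{z}{z-1}\bigg]_{p-1}\pmod{p^2}. $$
   Context: $\mathbb Z_p$ denotes the $p$-adic integers and $\mathbb Z_p^\times$ its units. For $\alpha\in\mathbb Z_p$, $\langle\alpha\rangle_p$ is the unique integer in $\{0,1,\ldots,p-1\}$ congruent to $\alpha$ modulo $p$, and $\lambda_p(\alpha):=-\langle-\alpha\rangle_p+\frac{\alpha+\langle-\alpha\rangle_p}{p}\cdot(p-1)$. For $a\in\mathbb Z$, $s\in\mathbb Z_p$ and $w\in\mathbb Z_p^\times$, the power $w^{a+s(p-1)}$ is defined as $w^{a}\sum_{k=0}^\infty\binom{s}{k}(w^{p-1}-1)^k$ (this is well defined); in particular $w^{1-\lambda_p(\alpha)}$ is defined for $w\in\mathbb Z_p^\times$. Pochhammer symbol: $(x)_0=1$, $(x)_k=x(x+1)\cdots(x+k-1)$. For $n\ge 0$, ${}_{2}F_1\Big[\begin{matrix}\alpha&\beta\\&\gamma\end{matrix}\Big|\,z\Big]_n=\sum_{k=0}^{n}\frac{(\alpha)_k(\beta)_k}{(\gamma)_k}\cdot\frac{z^k}{k!}$.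 For $x,y\in\mathbb Z_p$, $x\equiv y\pmod{p^2}$ means $x-y\in p^2\mathbb Z_p$. *)

theory Defs
  imports
    Complex_Main
    "HOL-Library.Product_Plus"
    "HOL-Computational_Algebra.Factorial_Ring"
    "Berlekamp_Zassenhaus.Finite_Field"
begin

section \<open>The ring of p-adic integers\<close>

text \<open>
  The prime p is the cardinality of the type argument, as for the prime fields
  \<^typ>\<open>'p mod_ring\<close>. The p-adic integers are the inverse limit of the rings of
  integers modulo \<open>p ^ n\<close>: an element is the compatible sequence of its least
  nonnegative residues.
\<close>

typedef (overloaded) 'p padic_int =
  "{f :: nat \<Rightarrow> int. \<forall>n. 0 \<le> f n \<and> f n < int CARD('p::prime_card) ^ n \<and>
      f (Suc n) mod int CARD('p) ^ n = f n}"
  morphisms padic_residue Abs_padic_int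
proof -
  have "CARD('p) > 0"
    using prime_card[where 'a = 'p] prime_gt_0_nat by blast
  then show ?thesis
    by (intro exI[of _ "\<lambda>_. 0"]) simp
qed

setup_lifting type_definition_padic_int

lemma CARD_prime_card_gt_1: "1 < int CARD('p::prime_card)"
  using prime_card[where 'a = 'p] prime_gt_1_nat by fastforce

lemma CARD_prime_card_pos [simp]: "0 < int CARD('p::prime_card) ^ n"
  using CARD_prime_card_gt_1[where 'p = 'p] by simp

lemma mod_Suc_power_mod [simp]: "a mod q ^ Suc n mod q ^ n = a mod (q::int) ^ n"
  by (rule mod_mod_cancel) simp

lemma mod_mult_power_mod [simp]: "a mod (q * q ^ n) mod q ^ n = a mod (q::int) ^ n"
  by (rule mod_mod_cancel) simp

instantiation padic_int :: (prime_card) comm_ring_1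
begin

lift_definition zero_padic_int :: "'a padic_int" is "\<lambda>_. 0"
  by (metis CARD_prime_card_pos mod_0 order_refl)

lift_definition one_padic_int :: "'a padic_int" is "\<lambda>n. 1 mod int CARD('a) ^ n"
  by simp

lift_definition plus_padic_int :: "'a padic_int \<Rightarrow> 'a padic_int \<Rightarrow> 'a padic_int"
  is "\<lambda>f g n. (f n + g n) mod int CARD('a) ^ n"
  by (simp del: power_Suc) (metis mod_add_eq)

lift_definition uminus_padic_int :: "'a padic_int \<Rightarrow> 'a padic_int"
  is "\<lambda>f n. (- f n) mod int CARD('a) ^ n"
  by (simp del: power_Suc) (metis mod_minus_eq)

lift_definition minus_padic_int :: "'a padic_int \<Rightarrow> 'a padic_int \<Rightarrow> 'a padic_int"
  is "\<lambda>f g n. (f n - g n) mod int CARD('a) ^ n"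
  by (simp del: power_Suc) (metis mod_diff_eq)

lift_definition times_padic_int :: "'a padic_int \<Rightarrow> 'a padic_int \<Rightarrow> 'a padic_int"
  is "\<lambda>f g n. (f n * g n) mod int CARD('a) ^ n"
  by (simp del: power_Suc) (metis mod_mult_eq)

instance
proof
  fix a b c :: "'a padic_int"
  show "a * b * c = a * (b * c)"
    by transfer (simp add: fun_eq_iff mod_simps mult_ac)
  show "a * b = b * a"
    by transfer (simp add: fun_eq_iff mult_ac)
  show "1 * a = a"
    by transfer (simp add: fun_eq_iff mod_simps)
  show "a + b + c = a + (b + c)"
    by transfer (simp add: fun_eq_iff mod_simps add_ac)
  show "a + b = b + a"
    by transfer (simp add: fun_eq_iff add_ac)
  show "0 + a = a"
    by transfer (simp add: fun_eq_iff)
  show "- a + a = 0"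
    by transfer (simp add: fun_eq_iff mod_simps)
  show "a - b = a + - b"
    by transfer (simp add: fun_eq_iff mod_simps)
  show "(a + b) * c = a * c + b * c"
    by transfer (simp add: fun_eq_iff mod_simps algebra_simps)
  show "(0::'a padic_int) \<noteq> 1"
  proof
    assume "(0::'a padic_int) = 1"
    then have "padic_residue (0::'a padic_int) 1 = padic_residue (1::'a padic_int) 1"
      by simp
    then show False
      using CARD_prime_card_gt_1[where 'p = 'a]
      by (simp add: zero_padic_int.rep_eq one_padic_int.rep_eq)
  qed
qed

end

lemma padic_residue_bounds:
  fixes x :: "'p::prime_card padic_int"
  shows "0 \<le> padic_residue x n" "padic_residue x n < int CARD('p) ^ n"
  using padic_residue[of x] by auto

lemma padic_residue_mod:
  fixes x :: "'p::prime_card padic_int"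
  assumes "m \<le> n"
  shows "padic_residue x n mod int CARD('p) ^ m = padic_residue x m"
  using assms
proof (induction n rule: dec_induct)
  case base
  then show ?case
    using padic_residue_bounds[of x m] by simp
next
  case (step n)
  have "int CARD('p) ^ m dvd int CARD('p) ^ n"
    using step.hyps by (simp add: le_imp_power_dvd)
  then have "padic_residue x (Suc n) mod int CARD('p) ^ m =
      padic_residue x (Suc n) mod int CARD('p) ^ n mod int CARD('p) ^ m"
    by (simp add: mod_mod_cancel)
  also have "padic_residue x (Suc n) mod int CARD('p) ^ n = padic_residue x n"
    using padic_residue[of x] by auto
  finally show ?case
    using step.IH by simp
qed

lemma padic_residue_of_nat:
  "padic_residue (of_nat k :: 'p::prime_card padic_int) n = int k mod int CARD('p) ^ n"
  by (induction k)
    (simp_all add: zero_padic_int.rep_eq one_padic_int.rep_eq plus_padic_int.rep_eq mod_simps)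

lemma CARD_power_dvd_iff:
  fixes x :: "'p::prime_card padic_int"
  shows "of_nat CARD('p) ^ n dvd x \<longleftrightarrow> padic_residue x n = 0"
proof
  have pow: "of_nat CARD('p) ^ n = (of_nat (CARD('p) ^ n) :: 'p padic_int)"
    by simp
  show "padic_residue x n = 0" if "of_nat CARD('p) ^ n dvd x"
  proof -
    from that obtain y where "x = of_nat (CARD('p) ^ n) * y"
      unfolding pow by (elim dvdE)
    moreover have "padic_residue (of_nat (CARD('p) ^ n) :: 'p padic_int) n = 0"
      by (metis mod_self of_nat_power padic_residue_of_nat)
    ultimately show ?thesis
      by (simp only: times_padic_int.rep_eq mult_zero_left mod_0)
  qed
  show "of_nat CARD('p) ^ n dvd x" if x0: "padic_residue x n = 0"
  proof -
    let ?p = "int CARD('p)"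
    define f where "f k = padic_residue x (k + n) div ?p ^ n" for k
    have f: "padic_residue x (k + n) = ?p ^ n * f k" for k
    proof -
      have "padic_residue x (k + n) mod ?p ^ n = 0"
        using padic_residue_mod[of n "k + n" x] x0 by simp
      then show ?thesis
        by (simp add: f_def mod_0_imp_dvd)
    qed
    have "0 \<le> f k \<and> f k < ?p ^ k \<and> f (Suc k) mod ?p ^ k = f k" for k
    proof (intro conjI)
      show "0 \<le> f k"
        using padic_residue_bounds(1)[of x "k + n"]
        by (simp add: f_def pos_imp_zdiv_nonneg_iff)
      have "?p ^ n * f k < ?p ^ n * ?p ^ k"
        using padic_residue_bounds(2)[of x "k + n"]
        unfolding f power_add by (simp only: mult.commute)
      then show "f k < ?p ^ k"
        using CARD_prime_card_pos[where 'p = 'p, of n] mult_less_cancel_left_pos by blast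
      have "?p ^ n * (f (Suc k) mod ?p ^ k) = (?p ^ n * f (Suc k)) mod (?p ^ n * ?p ^ k)"
        by (rule mult_mod_right)
      also have "\<dots> = padic_residue x (Suc k + n) mod ?p ^ (k + n)"
        unfolding f power_add by (simp only: mult.commute)
      also have "\<dots> = ?p ^ n * f k"
        by (subst padic_residue_mod) (simp, rule f)
      finally have "?p ^ n * (f (Suc k) mod ?p ^ k) = ?p ^ n * f k" .
      then show "f (Suc k) mod ?p ^ k = f k"
        using CARD_prime_card_pos[where 'p = 'p, of n] by (metis less_irrefl mult_left_cancel)
    qed
    then have rep: "padic_residue (Abs_padic_int f :: 'p padic_int) = f"
      by (intro Abs_padic_int_inverse) blast
    have "x = of_nat (CARD('p) ^ n) * Abs_padic_int f"
    proof (rule padic_residue_inject[THEN iffD1], rule ext)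
      fix k
      have "padic_residue x k = padic_residue x (k + n) mod ?p ^ k"
        by (rule padic_residue_mod[symmetric]) simp
      also have "\<dots> = ?p ^ n * f k mod ?p ^ k"
        by (simp only: f)
      moreover have "padic_residue (of_nat (CARD('p) ^ n) :: 'p padic_int) k = ?p ^ n mod ?p ^ k"
        by (metis of_nat_power padic_residue_of_nat)
      ultimately show "padic_residue x k =
          padic_residue (of_nat (CARD('p) ^ n) * Abs_padic_int f :: 'p padic_int) k"
        by (simp only: times_padic_int.rep_eq rep mod_mult_left_eq)
    qed
    then show ?thesis
      unfolding pow by (rule dvdI)
  qed
qed

lemma padic_int_eq_0_iff:
  fixes x :: "'p::prime_card padic_int"
  shows "x = 0 \<longleftrightarrow> (\<forall>n. padic_residue x n = 0)"
  by (simp add: padic_residue_inject[symmetric] zero_padic_int.rep_eq fun_eq_iff)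

instance padic_int :: (prime_card) idom
proof
  fix x y :: "'a padic_int"
  let ?p = "int CARD('a)"
  assume "x \<noteq> 0" "y \<noteq> 0"
  then obtain m n where mn: "padic_residue x m \<noteq> 0" "padic_residue y n \<noteq> 0"
    by (auto simp: padic_int_eq_0_iff)
  define a b where "a = padic_residue x (m + n)" and "b = padic_residue y (m + n)"
  have "a mod ?p ^ m \<noteq> 0" "b mod ?p ^ n \<noteq> 0"
    using mn padic_residue_mod[of m "m + n" x] padic_residue_mod[of n "m + n" y]
    by (simp_all add: a_def b_def)
  then have nd: "\<not> ?p ^ m dvd a" "\<not> ?p ^ n dvd b"
    by (simp_all add: dvd_eq_mod_eq_0)
  have "\<not> ?p ^ (m + n) dvd a * b"
  proof
    assume dvd: "?p ^ (m + n) dvd a * b"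
    have prime: "prime ?p"
      by (rule prime_card_int)
    have nz: "a \<noteq> 0" "b \<noteq> 0"
      using nd by auto
    have nu: "\<not> is_unit ?p"
      using prime not_prime_unit by blast
    have "multiplicity ?p (a * b) = multiplicity ?p a + multiplicity ?p b"
      using prime nz by (simp add: prime_elem_multiplicity_mult_distrib)
    moreover have "m + n \<le> multiplicity ?p (a * b)"
      using dvd nz nu by (intro multiplicity_geI) auto
    moreover have "multiplicity ?p a < m" "multiplicity ?p b < n"
      using nd nz nu by (auto intro!: multiplicity_lessI)
    ultimately show False
      by simp
  qed
  then have "padic_residue (x * y) (m + n) \<noteq> 0"
    by (simp add: times_padic_int.rep_eq a_def b_def dvd_eq_mod_eq_0)
  then show "x * y \<noteq> 0"
    by (auto simp: padic_int_eq_0_iff)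
qed

instance padic_int :: (prime_card) ring_char_0
proof
  show "inj (of_nat :: nat \<Rightarrow> 'a padic_int)"
  proof
    fix i j :: nat
    assume eq: "(of_nat i :: 'a padic_int) = of_nat j"
    define k where "k = i + j"
    have "k < 2 ^ k"
      by simp
    also have "2 ^ k \<le> CARD('a) ^ k"
      using CARD_prime_card_gt_1[where 'p = 'a] by (intro power_mono) auto
    finally have "i < CARD('a) ^ k" "j < CARD('a) ^ k"
      by (auto simp: k_def)
    moreover have "int i mod int CARD('a) ^ k = int j mod int CARD('a) ^ k"
      using eq padic_residue_of_nat[of i k, where 'p = 'a] padic_residue_of_nat[of j k, where 'p = 'a]
      by simp
    then have "i mod CARD('a) ^ k = j mod CARD('a) ^ k"
      by (metis of_nat_eq_iff of_nat_mod of_nat_power)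
    ultimately show "i = j"
      by (metis mod_less)
  qed
qed

text \<open>
  Division is exact division, with the usual convention that the quotient is 0 if the
  divisor is 0 or does not divide the dividend.
\<close>

instantiation padic_int :: (prime_card) idom_divide
begin

definition divide_padic_int :: "'a padic_int \<Rightarrow> 'a padic_int \<Rightarrow> 'a padic_int" where
  "divide_padic_int x y = (if y \<noteq> 0 \<and> y dvd x then THE q. x = q * y else 0)"

instance
  by standard (auto simp: divide_padic_int_def)

end

instance padic_int :: (prime_card) algebraic_semidom ..

instantiation padic_int :: (prime_card) inverse
begin

definition inverse_padic_int :: "'a padic_int \<Rightarrow> 'a padic_int" where
  "inverse_padic_int x = 1 div x"

instance ..

end

definition padic_val :: "'p::prime_card padic_int \<Rightarrow> nat" where
  "padic_val x = (GREATEST n. of_nat CARD('p) ^ n dvd x)"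

lemma CARD_power_dvd_iff_padic_val:
  fixes x :: "'p::prime_card padic_int"
  assumes "x \<noteq> 0"
  shows "of_nat CARD('p) ^ n dvd x \<longleftrightarrow> n \<le> padic_val x"
proof -
  let ?P = "\<lambda>n. of_nat CARD('p) ^ n dvd x"
  obtain N where N: "padic_residue x N \<noteq> 0"
    using assms by (auto simp: padic_int_eq_0_iff)
  have bound: "n \<le> N" if "?P n" for n
  proof (rule ccontr)
    assume "\<not> n \<le> N"
    then have "?P N"
      using that by (metis dvd_trans le_imp_power_dvd nat_le_linear)
    then show False
      using N by (simp add: CARD_power_dvd_iff)
  qed
  have "?P (padic_val x)"
    unfolding padic_val_def using bound by (intro GreatestI_nat[of ?P 0 N]) auto
  moreover have "n \<le> padic_val x" if "?P n"
    unfolding padic_val_def using bound that by (intro Greatest_le_nat[of ?P n N]) auto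
  ultimately show ?thesis
    by (auto intro: dvd_trans[OF le_imp_power_dvd])
qed

instantiation padic_int :: (prime_card) metric_space
begin

definition dist_padic_int :: "'a padic_int \<Rightarrow> 'a padic_int \<Rightarrow> real" where
  "dist_padic_int x y =
     (if x = y then 0 else (1 / real CARD('a)) ^ padic_val (x - y))"

definition uniformity_padic_int :: "('a padic_int \<times> 'a padic_int) filter" where
  "uniformity_padic_int = (INF e\<in>{0 <..}. principal {(x, y). dist x y < e})"

definition open_padic_int :: "'a padic_int set \<Rightarrow> bool" where
  "open_padic_int U \<longleftrightarrow> (\<forall>x\<in>U. \<forall>\<^sub>F (x', y) in uniformity. x' = x \<longrightarrow> y \<in> U)"

instance
proof
  have p: "real CARD('a) > 1"
    using CARD_prime_card_gt_1[where 'p = 'a] by simp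
  fix x y z :: "'a padic_int"
  show "dist x y = 0 \<longleftrightarrow> x = y"
    using p by (simp add: dist_padic_int_def)
  let ?v = "padic_val :: 'a padic_int \<Rightarrow> nat"
  let ?q = "1 / real CARD('a)"
  show "dist x y \<le> dist x z + dist y z"
  proof (cases "x = y \<or> x = z \<or> y = z")
    case True
    have "c dvd z - y \<longleftrightarrow> c dvd y - z" for c
      using dvd_minus_iff[of c "y - z"] by simp
    then have sym: "?v (z - y) = ?v (y - z)"
      by (simp only: padic_val_def)
    show ?thesis
      using True p sym by (auto simp: dist_padic_int_def)
  next
    case False
    define n where "n = min (?v (x - z)) (?v (y - z))"
    have "of_nat CARD('a) ^ n dvd (x - z) - (y - z)"
      using False by - (rule dvd_diff; simp add: CARD_power_dvd_iff_padic_val n_def)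
    then have "n \<le> ?v (x - y)"
      using False by (simp add: CARD_power_dvd_iff_padic_val)
    then have "?q ^ ?v (x - y) \<le> ?q ^ n"
      using p by (intro power_decreasing) auto
    also have "\<dots> \<le> ?q ^ ?v (x - z) + ?q ^ ?v (y - z)"
      by (simp add: n_def min_def)
    finally show ?thesis
      using False by (simp add: dist_padic_int_def)
  qed
qed (simp_all add: uniformity_padic_int_def open_padic_int_def)

end

section \<open>Exponents, powers and truncated hypergeometric series\<close>

definition padic_rem :: "'p::prime_card padic_int \<Rightarrow> int" where
  "padic_rem \<alpha> = (THE r. r \<in> {0..<int CARD('p)} \<and> of_nat CARD('p) dvd (\<alpha> - of_int r))"

text \<open>
  The pair \<open>(a, s)\<close> stands for the exponent \<open>a + s (p - 1)\<close>. It has to be kept as a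
  pair, because the power of a unit is not determined by the p-adic integer
  \<open>a + s (p - 1)\<close>: both \<open>(1, 0)\<close> and \<open>(0, 1 / (p - 1))\<close> have the value 1, but the second
  one yields the projection to the units congruent to 1 modulo p.
  The exponent 1 is \<open>(1, 0)\<close>, and differences are componentwise.
\<close>

type_synonym 'p padic_exponent = "int \<times> 'p padic_int"

definition padic_lambda :: "'p::prime_card padic_int \<Rightarrow> 'p padic_exponent" where
  "padic_lambda \<alpha> =
     (- padic_rem (- \<alpha>), (\<alpha> + of_int (padic_rem (- \<alpha>))) / of_nat CARD('p))"

text \<open>
  The product is divisible by \<open>fact k\<close> for every p-adic integer \<open>s\<close>. The library's
  \<open>gchoose\<close> has the same definition, but its use is restricted to fields.
\<close>

definition padic_binomial :: "'p::prime_card padic_int \<Rightarrow> nat \<Rightarrow> 'p padic_int" where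
  "padic_binomial s k = (\<Prod>i=0..<k. s - of_nat i) / fact k"

definition padic_power :: "'p::prime_card padic_int \<Rightarrow> 'p padic_exponent \<Rightarrow> 'p padic_int" where
  "padic_power w e =
     w powi fst e * (\<Sum>k. padic_binomial (snd e) k * (w ^ (CARD('p) - 1) - 1) ^ k)"

text \<open>
  The quotients are meant for denominators that are units, such as \<open>\<gamma> = 1\<close> and \<open>n < p\<close>.
\<close>

definition hypergeom_2F1_trunc ::
  "nat \<Rightarrow> 'p::prime_card padic_int \<Rightarrow> 'p padic_int \<Rightarrow> 'p padic_int \<Rightarrow> 'p padic_int \<Rightarrow> 'p padic_int"
where
  "hypergeom_2F1_trunc n \<alpha> \<beta> \<gamma> z =
     (\<Sum>k=0..n. pochhammer \<alpha> k * pochhammer \<beta> k / pochhammer \<gamma> k * (z ^ k / fact k))"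

definition padic_cong :: "'p::prime_card padic_int \<Rightarrow> 'p padic_int \<Rightarrow> 'p padic_int \<Rightarrow> bool" where
  "padic_cong m x y \<longleftrightarrow> m dvd x - y"

end

theory Submission
  imports Defs
begin

text \<open>
  Write \<open>\<alpha> = - a + p s\<close> with \<open>0 \<le> a < p\<close>. Modulo \<open>p\<^sup>2\<close> a power \<open>w\<close> to the exponent
  \<open>1 - \<lambda>\<^sub>p(\<alpha>)\<close> is \<open>w ^ (1 + a) (1 - s (w ^ (p - 1) - 1))\<close>, and both sides of the congruence are
  affine in \<open>s\<close>. It is therefore enough to treat \<open>s = 0\<close> and \<open>s = - 1\<close>, that is,
  \<open>\<alpha> = - N\<close> with \<open>N = a\<close> or \<open>N = p + a\<close>. Then everything is a polynomial in \<open>z\<close>, and the series on the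
  right is the polynomial \<open>G(x)\<close> with the first \<open>p\<close> coefficients \<open>g\<^sub>k\<close> of the shifted Legendre polynomial.
  The coefficients of \<open>(1 - z)\<^sup>N G(z / (z - 1))\<close> below degree \<open>p\<close> are the squares of the
  binomial coefficients of \<open>N\<close>, by Vandermonde. This settles \<open>N = a\<close>. For \<open>N = p + a\<close>,
  \<open>G\<close> satisfies the Legendre differential equation modulo \<open>p\<^sup>2\<close>, which determines a
  polynomial of degree less than \<open>p\<close> by its constant term. Hence \<open>G(1 - x)\<close> is \<open>G(1) G(x)\<close>
  modulo \<open>p\<^sup>2\<close>, with \<open>G(1)\<^sup>2 = 1\<close> and therefore \<open>G(1) = (-1)\<^sup>a\<close>. By this symmetry the
  coefficients of degree \<open>p\<close> and above are the negatives of the ones below, in reverse order.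
\<close>

section \<open>Truncated shifted Legendre polynomials\<close>

lemma alternating_sum_binomial_Suc:
  fixes f :: "nat \<Rightarrow> int"
  shows "(\<Sum>k\<le>Suc m. (-1) ^ k * int (Suc m choose k) * f k) =
    (\<Sum>k\<le>m. (-1) ^ k * int (m choose k) * (f k - f (Suc k)))"
proof -
  have "(\<Sum>k\<le>Suc m. (-1) ^ k * int (Suc m choose k) * f k) =
      f 0 + (\<Sum>k\<le>m. (-1) ^ Suc k * int (Suc m choose Suc k) * f (Suc k))"
    by (subst sum.atMost_Suc_shift) simp
  also have "\<dots> = f 0 + (\<Sum>k\<le>m. (-1) ^ Suc k * int (m choose Suc k) * f (Suc k))
      - (\<Sum>k\<le>m. (-1) ^ k * int (m choose k) * f (Suc k))"
    by (simp add: sum_subtractf[symmetric] sum.distrib[symmetric] algebra_simps sum_negf[symmetric])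
  also have "f 0 + (\<Sum>k\<le>m. (-1) ^ Suc k * int (m choose Suc k) * f (Suc k)) =
      (\<Sum>k\<le>Suc m. (-1) ^ k * int (m choose k) * f k)"
    by (subst sum.atMost_Suc_shift) simp
  also have "\<dots> = (\<Sum>k\<le>m. (-1) ^ k * int (m choose k) * f k)"
    by simp
  finally show ?thesis
    by (simp add: sum_subtractf algebra_simps)
qed

text \<open>Up to sign this is the \<open>m\<close>-th finite difference of a binomial coefficient
  in its upper argument. By Pascal's rule each difference lowers \<open>j\<close> by one; at
  \<open>j = 0\<close> the function is constant and the next difference vanishes.\<close>

lemma alternating_sum_binomial_shift:
  "(\<Sum>k\<le>m. (-1) ^ k * int (m choose k) * int ((N + k) choose j)) =
    (-1) ^ m * (if m \<le> j then int (N choose (j - m)) else 0)"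
proof (induction m arbitrary: j)
  case 0
  then show ?case by simp
next
  case (Suc m)
  show ?case
  proof (cases j)
    case 0
    then show ?thesis
      by (subst alternating_sum_binomial_Suc) simp
  next
    case (Suc i)
    have "(\<Sum>k\<le>Suc m. (-1) ^ k * int (Suc m choose k) * int ((N + k) choose j)) =
      - (\<Sum>k\<le>m. (-1) ^ k * int (m choose k) * int ((N + k) choose i))"
      by (subst alternating_sum_binomial_Suc) (simp add: Suc sum_negf[symmetric])
    then show ?thesis
      using Suc.IH[of i] Suc by simp
  qed
qed

lemma alternating_sum_binomial_symmetric:
  assumes "m \<le> N"
  shows "(\<Sum>k\<le>m. (-1) ^ k * int (m choose k) * int ((N + k) choose k)) = (-1) ^ m * int (N choose m)"
proof -
  have "(N + k) choose k = (N + k) choose N" for k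
    using binomial_symmetric[of k "N + k"] by simp
  then show ?thesis
    using alternating_sum_binomial_shift[of m N N] assms binomial_symmetric[OF assms] by simp
qed

text \<open>Compare the coefficients of \<open>y ^ (N - m)\<close> in
  \<open>y ^ k * (1 + y) ^ (N - k)\<close> after expanding \<open>y ^ k = ((1 + y) - 1) ^ k\<close>.
  The bound \<open>n\<close> does not depend on \<open>k\<close>, so that the sums over
  \<open>k\<close> and \<open>j\<close> can later be exchanged.\<close>

lemma binomial_diff_alternating_sum:
  assumes "k \<le> N" "m \<le> N" "k < n"
  shows "int ((N - k) choose m) = (\<Sum>j<n. (-1) ^ j * int (k choose j) * int ((N - j) choose (N - m)))"
proof -
  have "(\<Sum>j<n. (-1) ^ j * int (k choose j) * int ((N - j) choose (N - m))) =
      (\<Sum>j\<le>k. (-1) ^ j * int (k choose j) * int ((N - j) choose (N - m)))"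
    using assms by (intro sum.mono_neutral_right) auto
  also have "\<dots> = (\<Sum>j\<le>k. (-1) ^ (k - j) * int (k choose (k - j)) * int ((N - (k - j)) choose (N - m)))"
    by (rule sum.nat_diff_reindex[symmetric, of _ "Suc k", simplified lessThan_Suc_atMost diff_Suc_Suc])
  also have "\<dots> = (-1) ^ k * (\<Sum>j\<le>k. (-1) ^ j * int (k choose j) * int ((N - k + j) choose (N - m)))"
    unfolding sum_distrib_left
  proof (rule sum.cong)
    fix j assume "j \<in> {..k}"
    then have *: "j \<le> k" by simp
    have "(-1::int) ^ k = (-1) ^ (k - j) * (-1) ^ j"
      using * by (simp add: power_add[symmetric])
    moreover have "N - (k - j) = N - k + j"
      using * assms by simp
    ultimately show "(-1) ^ (k - j) * int (k choose (k - j)) * int ((N - (k - j)) choose (N - m)) =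
      (-1) ^ k * ((-1) ^ j * int (k choose j) * int ((N - k + j) choose (N - m)))"
      using * by (simp add: binomial_symmetric[of j k] mult.assoc)
  qed simp
  also have "\<dots> = (if k \<le> N - m then int ((N - k) choose (N - m - k)) else 0)"
    by (simp add: alternating_sum_binomial_shift)
  also have "\<dots> = int ((N - k) choose m)"
    using assms binomial_symmetric[of m "N - k"] by (auto simp: diff_commute add.commute)
  finally show ?thesis ..
qed

lemma choose_Suc_absorb:
  "(int k + 1) * int (n choose Suc k) = (int n - int k) * int (n choose k)"
proof (cases "k \<le> n")
  case True
  have "Suc k * (n choose Suc k) = (n - k) * (n choose k)"
    by (metis (no_types) Suc_times_binomial_eq binomial_absorption mult.commute binomial_absorb_comp diff_Suc_1)
  then have "int (Suc k * (n choose Suc k)) = int ((n - k) * (n choose k))" by simp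
  then show ?thesis using True by (simp add: of_nat_diff algebra_simps)
qed (auto simp: binomial_eq_0)

text \<open>The coefficients of the shifted Legendre polynomial \<open>P\<^sub>N(1 - 2 x)\<close>.\<close>

definition legendre_coeff :: "nat \<Rightarrow> nat \<Rightarrow> int" where
  "legendre_coeff N k = (-1) ^ k * int (N choose k) * int ((N + k) choose k)"

text \<open>Coefficientwise this is the equation
  \<open>x (1 - x) G'' + (1 - 2 x) G' + N (N + 1) G = 0\<close>.\<close>

lemma legendre_coeff_Suc:
  "(int k + 1)^2 * legendre_coeff N (Suc k) =
    - ((int N - int k) * (int N + int k + 1) * legendre_coeff N k)"
proof -
  note 1 = choose_Suc_absorb[of k N]
  have "int (Suc k * ((N + Suc k) choose Suc k)) = int (Suc (N + k) * ((N + k) choose k))"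
    using Suc_times_binomial_eq[of "N + k" k] by (metis add_Suc_right mult.commute)
  then have 2: "(int k + 1) * int ((N + Suc k) choose Suc k) = (int N + int k + 1) * int ((N + k) choose k)"
    by (simp del: binomial_Suc_Suc add: algebra_simps)
  have "(int k + 1)^2 * legendre_coeff N (Suc k) =
     - ((-1) ^ k * ((int k + 1) * int (N choose Suc k)) * ((int k + 1) * int ((N + Suc k) choose Suc k)))"
    unfolding legendre_coeff_def power2_eq_square by (simp del: binomial_Suc_Suc)
  also have "\<dots> = - ((int N - int k) * (int N + int k + 1) * legendre_coeff N k)"
    unfolding 1 2 legendre_coeff_def by simp
  finally show ?thesis .
qed

text \<open>Up to sign, the coefficients of the truncated polynomial after the substitution of \<open>1 - x\<close> for \<open>x\<close>.\<close>

definition legendre_taylor :: "nat \<Rightarrow> nat \<Rightarrow> nat \<Rightarrow> int" where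
  "legendre_taylor N n m = (\<Sum>k<n. legendre_coeff N k * int (k choose m))"

text \<open>The Legendre differential equation, coefficientwise; the truncation leaves the term with \<open>n\<^sup>2\<close>.\<close>

lemma legendre_taylor_Suc:
  "(int m + 1)^2 * legendre_taylor N n (Suc m) =
    (int N - int m) * (int N + int m + 1) * legendre_taylor N n m
      + (int n)^2 * int ((n - 1) choose m) * legendre_coeff N n"
proof -
  \<comment> \<open>\<open>V\<close> is a telescoping certificate: the recurrence operator in
    \<open>m\<close>, applied to the summand, gives \<open>V (Suc k) - V k\<close>. As
    \<open>V 0 = 0\<close>, only the boundary term \<open>V n\<close> survives, and it carries the
    factor \<open>n^2\<close>.\<close>
  define V where "V k = int ((k - 1) choose m) * (int k)^2 * legendre_coeff N k" for k
  have "legendre_coeff N k * ((int m + 1)^2 * int (k choose Suc m)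
      - (int N - int m) * (int N + int m + 1) * int (k choose m)) = V (Suc k) - V k" for k
  proof -
    note 1 = choose_Suc_absorb[of m k]
    have 2: "int k * int ((k - 1) choose m) = (int k - int m) * int (k choose m)"
    proof (cases "m \<le> k")
      case True
      have "int (k * ((k - 1) choose m)) = int ((k - m) * (k choose m))"
        using binomial_absorb_comp[of k m] by simp
      then show ?thesis using True by (simp add: of_nat_diff)
    qed (auto simp: binomial_eq_0)
    have 3: "V (Suc k) = int (k choose m) * - ((int N - int k) * (int N + int k + 1) * legendre_coeff N k)"
      unfolding V_def legendre_coeff_Suc[symmetric] by (simp add: add.commute)
    have 4: "V k = (int k - int m) * int (k choose m) * int k * legendre_coeff N k"
      unfolding V_def 2[symmetric] by (simp add: power2_eq_square)
    have 5: "(int m + 1)^2 * int (k choose Suc m) = (int m + 1) * ((int k - int m) * int (k choose m))"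
      unfolding 1[symmetric] by (simp add: power2_eq_square)
    show ?thesis unfolding right_diff_distrib 3 4 5 by (simp add: algebra_simps)
  qed
  then have "(\<Sum>k<n. legendre_coeff N k * ((int m + 1)^2 * int (k choose Suc m)
      - (int N - int m) * (int N + int m + 1) * int (k choose m))) = V n - V 0"
    by (simp add: sum_lessThan_telescope)
  then show ?thesis
    unfolding legendre_taylor_def V_def
    by (simp add: right_diff_distrib sum_subtractf sum_distrib_left mult_ac)
qed

text \<open>The summands are the coefficients of \<open>G(1 - x)\<close>, so they add up to its
  value at \<open>x = 1\<close>, which is \<open>G(0) = 1\<close>.\<close>

lemma sum_legendre_taylor:
  assumes "0 < n"
  shows "(\<Sum>m<n. (-1) ^ m * legendre_taylor N n m) = 1"
proof -
  have "(\<Sum>m<n. (-1) ^ m * legendre_taylor N n m) =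
      (\<Sum>k<n. legendre_coeff N k * (\<Sum>m<n. (-1) ^ m * int (k choose m)))"
    unfolding legendre_taylor_def sum_distrib_left
    by (subst sum.swap) (simp add: mult_ac)
  also have "\<dots> = (\<Sum>k<n. legendre_coeff N k * (if k = 0 then 1 else 0))"
  proof (rule sum.cong)
    fix k assume "k \<in> {..<n}"
    then have "(\<Sum>m<n. (-1) ^ m * int (k choose m)) = (\<Sum>m\<le>k. (-1) ^ m * int (k choose m))"
      by (intro sum.mono_neutral_right) auto
    also have "\<dots> = (if k = 0 then 1 else 0)"
      using choose_alternating_sum[of k, where 'a = int] by auto
    finally show "legendre_coeff N k * (\<Sum>m<n. (-1) ^ m * int (k choose m)) =
      legendre_coeff N k * (if k = 0 then 1 else 0)" by simp
  qed simp
  also have "\<dots> = legendre_coeff N 0"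
    using assms by (subst sum.remove[of _ 0]) auto
  finally show ?thesis
    by (simp add: legendre_coeff_def)
qed

text \<open>For \<open>n = p\<close> the boundary term of \<open>legendre_taylor_Suc\<close>
  vanishes modulo \<open>p^2\<close>, so both sides obey the same first-order recurrence in
  \<open>m\<close>. Its leading factor is invertible as long as the index stays below
  \<open>p\<close>.\<close>

lemma legendre_taylor_cong:
  assumes "prime p" "m < p"
  shows "[legendre_taylor N p m = legendre_taylor N p 0 * ((-1) ^ m * legendre_coeff N m)] (mod (int p)^2)"
  using assms(2)
proof (induction m)
  case 0
  then show ?case by (simp add: legendre_coeff_def)
next
  case (Suc m)
  let ?c = "(int N - int m) * (int N + int m + 1)"
  let ?u = "legendre_taylor N p"
  have "coprime (int m + 1) (int p)"
  proof -
    have "\<not> p dvd Suc m"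
      using Suc.prems by (auto dest: dvd_imp_le)
    then have "coprime p (Suc m)"
      using assms(1) prime_imp_coprime by blast
    then have "coprime (int (Suc m)) (int p)"
      by (simp only: coprime_int_iff coprime_commute)
    then show ?thesis by (simp add: add.commute)
  qed
  then have cop: "coprime ((int m + 1)^2) ((int p)^2)"
    by simp
  have "[(int m + 1)^2 * ?u (Suc m) = ?c * ?u m] (mod (int p)^2)"
    unfolding legendre_taylor_Suc by (simp add: cong_iff_dvd_diff)
  also have "[?c * ?u m = ?c * (?u 0 * ((-1) ^ m * legendre_coeff N m))] (mod (int p)^2)"
    using Suc by (intro cong_scalar_left) auto
  also have "?c * (?u 0 * ((-1) ^ m * legendre_coeff N m)) =
      (int m + 1)^2 * (?u 0 * ((-1) ^ Suc m * legendre_coeff N (Suc m)))"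
  proof -
    have "(int m + 1)^2 * (?u 0 * ((-1) ^ Suc m * legendre_coeff N (Suc m))) =
        ?u 0 * (-1) ^ Suc m * ((int m + 1)^2 * legendre_coeff N (Suc m))"
      by (simp only: mult_ac)
    also have "\<dots> = ?u 0 * (-1) ^ m * (?c * legendre_coeff N m)"
      unfolding legendre_coeff_Suc by simp
    finally show ?thesis
      by (simp only: mult_ac)
  qed
  finally show ?case
    using cop by (simp only: cong_mult_lcancel)
qed

text \<open>In the Vandermonde convolution every term except \<open>i = 0\<close> contains some
  \<open>p choose i\<close> with \<open>0 < i < p\<close>.\<close>

lemma choose_add_prime_cong:
  assumes "prime p" "k < p"
  shows "[int ((p + a) choose k) = int (a choose k)] (mod int p)"
proof -
  have "(p + a) choose k = (\<Sum>i\<le>k. (p choose i) * (a choose (k - i)))"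
    by (rule vandermonde[symmetric])
  also have "\<dots> = (\<Sum>i\<in>{..k} - {0}. (p choose i) * (a choose (k - i))) + (a choose k)"
    by (subst sum.remove[of _ 0]) auto
  finally have eq: "(p + a) choose k = (\<Sum>i\<in>{..k} - {0}. (p choose i) * (a choose (k - i))) + (a choose k)" .
  have "p dvd (\<Sum>i\<in>{..k} - {0}. (p choose i) * (a choose (k - i)))"
    using assms by (intro dvd_sum dvd_mult2 dvd_choose_prime) auto
  then have "int p dvd int (\<Sum>i\<in>{..k} - {0}. (p choose i) * (a choose (k - i)))"
    by (simp only: of_nat_dvd_iff)
  then show ?thesis
    unfolding eq cong_iff_dvd_diff by simp
qed


text \<open>Up to sign, the coefficients of \<open>(1 - z)\<^sup>N G(z / (z - 1))\<close>, where \<open>G\<close> is the polynomial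
  with the first \<open>n\<close> of the coefficients \<^term>\<open>legendre_coeff N\<close>.\<close>

definition legendre_pfaff :: "nat \<Rightarrow> nat \<Rightarrow> nat \<Rightarrow> int" where
  "legendre_pfaff N n m = (\<Sum>k<n. legendre_coeff N k * int ((N - k) choose (N - m)))"

lemma choose_mult_choose_diff:
  assumes "m \<le> N"
  shows "(N choose k) * ((N - k) choose (N - m)) = (N choose m) * (m choose k)"
proof (cases "k \<le> m")
  case True
  have "(N - k) choose (N - m) = (N - k) choose (m - k)"
    using binomial_symmetric[of "m - k" "N - k"] True assms by simp
  then show ?thesis
    using choose_mult[OF True assms] by simp
next
  case False
  then show ?thesis
    using assms by (cases "k \<le> N") (auto simp: binomial_eq_0)
qed

lemma legendre_coeff_mult_choose:
  assumes "m \<le> N"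
  shows "legendre_coeff N k * int ((N - k) choose (N - m)) =
    int (N choose m) * ((-1) ^ k * int (m choose k) * int ((N + k) choose k))"
proof -
  have "int (N choose k) * int ((N - k) choose (N - m)) = int (N choose m) * int (m choose k)"
    using choose_mult_choose_diff[OF assms] by (metis of_nat_mult)
  then show ?thesis
    unfolding legendre_coeff_def by (simp add: mult_ac)
qed

text \<open>One factor \<open>N choose m\<close> comes out of the sum. What remains stops at
  \<open>k = m\<close>, before the truncation at \<open>n\<close>, and yields the second
  factor.\<close>

lemma legendre_pfaff_low:
  assumes "m < n" "m \<le> N"
  shows "legendre_pfaff N n m = (-1) ^ m * (int (N choose m))^2"
proof -
  have "legendre_pfaff N n m =
      int (N choose m) * (\<Sum>k<n. (-1) ^ k * int (m choose k) * int ((N + k) choose k))"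
    unfolding legendre_pfaff_def using assms by (simp add: legendre_coeff_mult_choose sum_distrib_left)
  also have "(\<Sum>k<n. (-1) ^ k * int (m choose k) * int ((N + k) choose k)) =
      (\<Sum>k\<le>m. (-1) ^ k * int (m choose k) * int ((N + k) choose k))"
    using assms by (intro sum.mono_neutral_right) auto
  also have "\<dots> = (-1) ^ m * int (N choose m)"
    using assms by (intro alternating_sum_binomial_symmetric)
  finally show ?thesis
    by (simp add: power2_eq_square)
qed

text \<open>Replacing \<open>z\<close> by \<open>1 / z\<close> reverses the coefficients and turns
  \<open>x = z / (z - 1)\<close> into \<open>1 - x\<close>. The symmetry between
  \<open>G(1 - x)\<close> and \<open>G(1) G(x)\<close> thus becomes one between the degrees
  \<open>m\<close> and \<open>N - m\<close>.\<close>

lemma legendre_pfaff_reflect: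
  assumes "prime p" "m \<le> N"
  shows "[legendre_pfaff N p (N - m) = legendre_taylor N p 0 * legendre_pfaff N p m] (mod (int p)^2)"
proof -
  let ?u = "legendre_taylor N p"
  have "legendre_pfaff N p (N - m) = (\<Sum>k<p. \<Sum>j<p.
      legendre_coeff N k * ((-1) ^ j * int (k choose j) * int ((N - j) choose (N - m))))"
    unfolding legendre_pfaff_def
  proof (rule sum.cong)
    fix k assume "k \<in> {..<p}"
    then show "legendre_coeff N k * int ((N - k) choose (N - (N - m))) =
      (\<Sum>j<p. legendre_coeff N k * ((-1) ^ j * int (k choose j) * int ((N - j) choose (N - m))))"
      using binomial_diff_alternating_sum[of k N m p] assms
      by (cases "k \<le> N") (auto simp: sum_distrib_left legendre_coeff_def binomial_eq_0)
  qed simp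
  also have "\<dots> = (\<Sum>j<p. (-1) ^ j * int ((N - j) choose (N - m)) * ?u j)"
    unfolding legendre_taylor_def sum_distrib_left by (subst sum.swap) (simp add: mult_ac)
  finally have eq: "legendre_pfaff N p (N - m) =
      (\<Sum>j<p. (-1) ^ j * int ((N - j) choose (N - m)) * ?u j)" .
  have "[legendre_pfaff N p (N - m) = (\<Sum>j<p. (-1) ^ j * int ((N - j) choose (N - m)) *
      (?u 0 * ((-1) ^ j * legendre_coeff N j)))] (mod (int p)^2)"
    unfolding eq using assms by (intro cong_sum cong_scalar_left legendre_taylor_cong) auto
  also have "(\<Sum>j<p. (-1) ^ j * int ((N - j) choose (N - m)) *
      (?u 0 * ((-1) ^ j * legendre_coeff N j))) = ?u 0 * legendre_pfaff N p m"
    unfolding legendre_pfaff_def sum_distrib_left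
    by (intro sum.cong) (simp_all add: mult_ac power_add[symmetric] flip: mult.assoc[of "(-1) ^ _" "(-1) ^ _"])
  finally show ?thesis .
qed

text \<open>Here \<open>legendre_taylor N p 0\<close> is \<open>G(1)\<close>; the symmetry at
  \<open>x = 1\<close> compares \<open>G(0) = 1\<close> with its square.\<close>

lemma legendre_taylor_0_square:
  assumes "prime p"
  shows "[(legendre_taylor N p 0)^2 = 1] (mod (int p)^2)"
proof -
  let ?u = "legendre_taylor N p"
  have "1 = (\<Sum>m<p. (-1) ^ m * ?u m)"
    using sum_legendre_taylor prime_gt_0_nat[OF assms] by simp
  also have "[\<dots> = (\<Sum>m<p. (-1) ^ m * (?u 0 * ((-1) ^ m * legendre_coeff N m)))] (mod (int p)^2)"
    using assms by (intro cong_sum cong_scalar_left legendre_taylor_cong) auto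
  also have "(\<Sum>m<p. (-1) ^ m * (?u 0 * ((-1) ^ m * legendre_coeff N m))) = ?u 0 * ?u 0"
    unfolding legendre_taylor_def[of N p 0] sum_distrib_left
    by (intro sum.cong) (simp_all add: mult_ac flip: mult.assoc[of "(-1) ^ _" "(-1) ^ _"])
  finally show ?thesis
    by (simp add: power2_eq_square cong_sym)
qed

text \<open>Modulo \<open>p\<close> the value \<open>G(1)\<close> becomes that of the polynomial for
  \<open>a\<close>, which is complete because \<open>a < p\<close>.\<close>

lemma legendre_taylor_0_cong_prime:
  assumes "prime p" "a < p"
  shows "[legendre_taylor (p + a) p 0 = (-1) ^ a] (mod int p)"
proof -
  have "legendre_taylor (p + a) p 0 =
      (\<Sum>k<p. (-1) ^ k * int ((p + a) choose k) * int ((p + (a + k)) choose k))"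
    unfolding legendre_taylor_def legendre_coeff_def by (simp add: add.assoc)
  also have "[\<dots> = (\<Sum>k<p. (-1) ^ k * int (a choose k) * int ((a + k) choose k))] (mod int p)"
    using assms by (intro cong_sum cong_mult choose_add_prime_cong) auto
  also have "(\<Sum>k<p. (-1) ^ k * int (a choose k) * int ((a + k) choose k)) =
      (\<Sum>k\<le>a. (-1) ^ k * int (a choose k) * int ((a + k) choose k))"
    using assms by (intro sum.mono_neutral_right) auto
  also have "\<dots> = (-1) ^ a"
    using alternating_sum_binomial_symmetric[of a a] by simp
  finally show ?thesis .
qed

text \<open>Since \<open>p\<close> is odd and \<open>u\<close> is \<open>e\<close> modulo
  \<open>p\<close>, the factor \<open>u + e\<close> of \<open>u^2 - 1\<close> is prime to
  \<open>p\<close>. Hence \<open>p^2\<close> divides the other factor \<open>u - e\<close>.\<close>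

lemma legendre_taylor_0_cong:
  assumes "prime p" "odd p" "a < p"
  shows "[legendre_taylor (p + a) p 0 = (-1) ^ a] (mod (int p)^2)"
proof -
  define u where "u = legendre_taylor (p + a) p 0"
  define e :: int where "e = (-1) ^ a"
  have e: "e = 1 \<or> e = -1"
    by (cases "even a") (auto simp: e_def)
  have "int p dvd u - e"
    using legendre_taylor_0_cong_prime[OF assms(1,3)] by (simp add: u_def e_def cong_iff_dvd_diff)
  moreover have "\<not> int p dvd 2"
  proof
    assume "int p dvd 2"
    then have "p \<le> 2" by (auto dest: zdvd_imp_le)
    then show False using assms(1,2) prime_ge_2_nat[of p] by auto
  qed
  then have "\<not> int p dvd 2 * e"
    using e by auto
  ultimately have "\<not> int p dvd u + e"
    using dvd_diff[of "int p" "u + e" "u - e"] by auto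
  then have "coprime (int p) (u + e)"
    using assms(1) by (intro prime_imp_coprime) auto
  then have "coprime ((int p)^2) (u + e)"
    by simp
  moreover have "(int p)^2 dvd (u - e) * (u + e)"
    using legendre_taylor_0_square[OF assms(1), of "p + a"] e
    by (auto simp: u_def cong_iff_dvd_diff power2_eq_square algebra_simps)
  ultimately show ?thesis
    by (simp add: u_def e_def cong_iff_dvd_diff coprime_dvd_mult_left_iff)
qed

section \<open>The Pfaff transformation as a polynomial identity\<close>

text \<open>The sign comes from \<open>z / (z - 1) = - z / (1 - z)\<close>. Choosing
  \<open>N - m\<close> rather than \<open>m - k\<close> makes the coefficient vanish for
  \<open>m < k\<close>, so that \<open>m\<close> has the same range for every
  \<open>k\<close>.\<close>

lemma pfaff_monomial:
  fixes z :: "'a::comm_ring_1"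
  assumes "k \<le> N"
  shows "(-1) ^ k * z ^ k * (1 - z) ^ (N - k) =
    (\<Sum>m\<le>N. (-1) ^ m * of_nat ((N - k) choose (N - m)) * z ^ m)"
proof -
  have "(1 - z) ^ (N - k) = (\<Sum>i\<le>N - k. of_nat ((N - k) choose i) * (- z) ^ i)"
    using binomial_ring[of "- z" 1 "N - k"] by simp
  then have "(-1) ^ k * z ^ k * (1 - z) ^ (N - k) =
      (\<Sum>i\<le>N - k. (-1) ^ (k + i) * of_nat ((N - k) choose i) * z ^ (k + i))"
    by (simp add: sum_distrib_left power_add power_minus[of z] mult_ac)
  also have "\<dots> = (\<Sum>m\<in>{k..N}. (-1) ^ m * of_nat ((N - k) choose (N - m)) * z ^ m)"
  proof (rule sum.reindex_bij_witness[of _ "\<lambda>m. m - k" "\<lambda>i. k + i"])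
    fix i assume "i \<in> {..N - k}"
    then show "(-1) ^ (k + i) * of_nat ((N - k) choose (N - (k + i))) * z ^ (k + i) =
      (-1) ^ (k + i) * of_nat ((N - k) choose i) * z ^ (k + i)"
      using binomial_symmetric[of i "N - k"] by simp
  qed (use assms in auto)
  also have "\<dots> = (\<Sum>m\<le>N. (-1) ^ m * of_nat ((N - k) choose (N - m)) * z ^ m)"
    using assms by (intro sum.mono_neutral_left) (auto simp: binomial_eq_0)
  finally show ?thesis .
qed

lemma legendre_pfaff_eval:
  fixes z :: "'a::comm_ring_1"
  shows "(\<Sum>k<n. (-1) ^ k * of_int (legendre_coeff N k) * z ^ k * (1 - z) ^ (N - k)) =
    (\<Sum>m\<le>N. (-1) ^ m * of_int (legendre_pfaff N n m) * z ^ m)"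
proof -
  have "(\<Sum>k<n. (-1) ^ k * of_int (legendre_coeff N k) * z ^ k * (1 - z) ^ (N - k)) =
    (\<Sum>k<n. \<Sum>m\<le>N. of_int (legendre_coeff N k) * ((-1) ^ m * of_nat ((N - k) choose (N - m)) * z ^ m))"
  proof (rule sum.cong)
    fix k
    show "(-1) ^ k * of_int (legendre_coeff N k) * z ^ k * (1 - z) ^ (N - k) =
      (\<Sum>m\<le>N. of_int (legendre_coeff N k) * ((-1) ^ m * of_nat ((N - k) choose (N - m)) * z ^ m))"
    proof (cases "k \<le> N")
      case True
      then show ?thesis
        unfolding sum_distrib_left[symmetric] pfaff_monomial[OF True, symmetric] by (simp only: mult_ac)
    qed (simp add: legendre_coeff_def binomial_eq_0)
  qed simp
  also have "\<dots> = (\<Sum>m\<le>N. (-1) ^ m * of_int (legendre_pfaff N n m) * z ^ m)"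
    unfolding legendre_pfaff_def of_int_sum sum_distrib_left sum_distrib_right
    by (subst sum.swap) (simp add: mult_ac)
  finally show ?thesis .
qed

lemma pfaff_choose_squares:
  fixes z :: "'a::comm_ring_1"
  assumes "a < n"
  shows "(\<Sum>k<n. (-1) ^ k * of_int (legendre_coeff a k) * z ^ k * (1 - z) ^ (a - k)) =
    (\<Sum>m<n. of_nat (a choose m)^2 * z ^ m)"
proof -
  have "(\<Sum>k<n. (-1) ^ k * of_int (legendre_coeff a k) * z ^ k * (1 - z) ^ (a - k)) =
      (\<Sum>m\<le>a. of_nat (a choose m)^2 * z ^ m)"
    unfolding legendre_pfaff_eval using assms
    by (intro sum.cong) (simp_all add: legendre_pfaff_low flip: mult.assoc power_add)
  also have "\<dots> = (\<Sum>m<n. of_nat (a choose m)^2 * z ^ m)"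
    using assms by (intro sum.mono_neutral_left) (auto simp: binomial_eq_0)
  finally show ?thesis .
qed

lemma of_int_dvd_of_int: "a dvd b \<Longrightarrow> (of_int a :: 'a::comm_ring_1) dvd of_int b"
  by (metis dvdE dvd_triv_left of_int_mult)

lemma choose_square_dvd:
  assumes "prime p" "a < m" "m < p"
  shows "(int p)^2 dvd (int ((p + a) choose m))^2"
  using choose_add_prime_cong[OF assms(1,3), of a] assms by (simp add: cong_0_iff binomial_eq_0)

text \<open>Below degree \<open>p\<close> the formula is exact. A degree \<open>m \<ge> p\<close> is
  reflected to \<open>p + a - m \<le> a\<close>, and the signs combine to
  \<open>(-1) ^ (p + 2 * a) = -1\<close>.\<close>

lemma legendre_pfaff_prime_cong:
  assumes "prime p" "odd p" "a < p" "m \<le> p + a"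
  shows "[(-1) ^ m * legendre_pfaff (p + a) p m =
    (if m < p then (int ((p + a) choose m))^2 else - ((int ((p + a) choose m))^2))] (mod (int p)^2)"
proof (cases "m < p")
  case True
  then show ?thesis
    by (simp add: legendre_pfaff_low)
next
  case False
  define i where "i = p + a - m"
  have i: "i \<le> p + a" "i < p" "m = p + a - i"
    using False assms by (auto simp: i_def)
  have ch: "(p + a) choose m = (p + a) choose i"
    using i binomial_symmetric by metis
  have "[(-1) ^ m * legendre_pfaff (p + a) p m =
      (-1) ^ m * (legendre_taylor (p + a) p 0 * legendre_pfaff (p + a) p i)] (mod (int p)^2)"
    unfolding i(3) using assms i by (intro cong_scalar_left legendre_pfaff_reflect) auto
  also have "[(-1) ^ m * (legendre_taylor (p + a) p 0 * legendre_pfaff (p + a) p i) =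
      (-1) ^ m * ((-1) ^ a * legendre_pfaff (p + a) p i)] (mod (int p)^2)"
    using assms by (intro cong_scalar_left cong_scalar_right legendre_taylor_0_cong)
  also have "(-1) ^ m * ((-1) ^ a * legendre_pfaff (p + a) p i) =
      (-1) ^ (m + a + i) * (int ((p + a) choose m))^2"
    using i(1,2) by (simp add: legendre_pfaff_low ch power_add mult_ac)
  also have "m + a + i = p + 2 * a"
    using assms(4) by (simp add: i_def)
  then have "odd (m + a + i)"
    using assms(2) by (metis even_add even_mult_iff even_numeral)
  then have "(-1::int) ^ (m + a + i) = -1"
    by (metis power_minus_odd power_one)
  finally show ?thesis
    using False by simp
qed

lemma pfaff_choose_squares_prime:
  fixes z :: "'a::comm_ring_1"
  assumes "prime p" "odd p" "a < p"
  shows "of_nat p^2 dvd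
    (\<Sum>k<p. (-1) ^ k * of_int (legendre_coeff (p + a) k) * z ^ k * (1 - z) ^ (p + a - k)) -
    ((\<Sum>m<p. of_nat ((p + a) choose m)^2 * z ^ m)
      - (\<Sum>m<p. of_nat ((p + a) choose m)^2 * z ^ (p + a - m)))"
proof -
  let ?N = "p + a"
  let ?c = "\<lambda>m. of_nat (?N choose m)^2 :: 'a"
  have P: "(of_nat p)^2 = (of_int ((int p)^2) :: 'a)"
    by simp
  have "(\<Sum>m\<le>?N. (if m < p then ?c m else - ?c m) * z ^ m) =
      (\<Sum>m<p. ?c m * z ^ m) - (\<Sum>m\<in>{p..?N}. ?c m * z ^ m)"
  proof -
    have "{..?N} = {..<p} \<union> {p..?N}" by auto
    then have "(\<Sum>m\<le>?N. (if m < p then ?c m else - ?c m) * z ^ m) =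
      (\<Sum>m<p. (if m < p then ?c m else - ?c m) * z ^ m) +
      (\<Sum>m\<in>{p..?N}. (if m < p then ?c m else - ?c m) * z ^ m)"
      by (simp only:) (rule sum.union_disjoint, auto)
    then show ?thesis
      by (simp add: sum_negf)
  qed
  also have "(\<Sum>m\<in>{p..?N}. ?c m * z ^ m) = (\<Sum>m\<le>a. ?c m * z ^ (?N - m))"
    by (rule sum.reindex_bij_witness[of _ "\<lambda>m. ?N - m" "\<lambda>m. ?N - m"])
      (auto simp: binomial_symmetric[symmetric])
  finally have *: "(\<Sum>m\<le>?N. (if m < p then ?c m else - ?c m) * z ^ m) =
      (\<Sum>m<p. ?c m * z ^ m) - (\<Sum>m\<le>a. ?c m * z ^ (?N - m))" .
  have "of_nat p^2 dvd
    (\<Sum>k<p. (-1) ^ k * of_int (legendre_coeff ?N k) * z ^ k * (1 - z) ^ (?N - k)) -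
      (\<Sum>m\<le>?N. (if m < p then ?c m else - ?c m) * z ^ m)"
    unfolding legendre_pfaff_eval sum_subtractf[symmetric] left_diff_distrib[symmetric]
  proof (intro dvd_sum dvd_mult2)
    fix m assume "m \<in> {..?N}"
    then have "(int p)^2 dvd (-1) ^ m * legendre_pfaff ?N p m -
        (if m < p then (int (?N choose m))^2 else - ((int (?N choose m))^2))"
      using legendre_pfaff_prime_cong[OF assms, of m] by (simp add: cong_iff_dvd_diff)
    then have "of_nat p^2 dvd (of_int ((-1) ^ m * legendre_pfaff ?N p m -
        (if m < p then (int (?N choose m))^2 else - ((int (?N choose m))^2))) :: 'a)"
      unfolding P by (rule of_int_dvd_of_int)
    then show "of_nat p^2 dvd (-1) ^ m * of_int (legendre_pfaff ?N p m) - (if m < p then ?c m else - ?c m)"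
      by (cases "m < p") simp_all
  qed
  \<comment> \<open>Reflection yields only the terms with \<open>m \<le> a\<close>, whereas the
    truncated series at \<open>1 / z\<close> runs over all \<open>m < p\<close>; the additional
    terms are multiples of \<open>p^2\<close>.\<close>
  moreover have "of_nat p^2 dvd (\<Sum>m\<in>{..<p} - {..a}. ?c m * z ^ (?N - m))"
  proof (intro dvd_sum dvd_mult2)
    fix m assume "m \<in> {..<p} - {..a}"
    then have "(int p)^2 dvd (int (?N choose m))^2"
      using assms by (intro choose_square_dvd) auto
    then have "of_nat p^2 dvd (of_int ((int (?N choose m))^2) :: 'a)"
      unfolding P by (rule of_int_dvd_of_int)
    then show "of_nat p^2 dvd ?c m"
      by simp
  qed
  ultimately have "of_nat p^2 dvd
    (\<Sum>k<p. (-1) ^ k * of_int (legendre_coeff ?N k) * z ^ k * (1 - z) ^ (?N - k)) -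
      (\<Sum>m\<le>?N. (if m < p then ?c m else - ?c m) * z ^ m)
    + (\<Sum>m\<in>{..<p} - {..a}. ?c m * z ^ (?N - m))"
    by (rule dvd_add)
  moreover have "(\<Sum>m<p. ?c m * z ^ (?N - m)) =
      (\<Sum>m\<in>{..<p} - {..a}. ?c m * z ^ (?N - m)) + (\<Sum>m\<le>a. ?c m * z ^ (?N - m))"
    using assms by (intro sum.subset_diff) auto
  ultimately show ?thesis
    unfolding * by (simp only: diff_diff_eq2 diff_add_eq add_diff_eq add.assoc add.commute add.left_commute)
qed

section \<open>Units, series and powers in the p-adic integers\<close>

lemma of_nat_CARD_dvd_iff:
  fixes x :: "'p::prime_card padic_int"
  shows "of_nat CARD('p) dvd x \<longleftrightarrow> padic_residue x 1 = 0"
  using CARD_power_dvd_iff[of 1 x] by simp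

lemma padic_residue_eq_iff:
  fixes x y :: "'p::prime_card padic_int"
  shows "padic_residue x n = padic_residue y n \<longleftrightarrow> of_nat CARD('p) ^ n dvd x - y"
proof -
  have "(padic_residue x n - padic_residue y n) mod int CARD('p) ^ n = 0 \<longleftrightarrow>
      padic_residue x n mod int CARD('p) ^ n = padic_residue y n mod int CARD('p) ^ n"
    by (simp add: mod_eq_dvd_iff mod_eq_0_iff_dvd)
  then show ?thesis
    using padic_residue_bounds[of x n] padic_residue_bounds[of y n]
    by (simp add: CARD_power_dvd_iff minus_padic_int.rep_eq)
qed

text \<open>A diagonal argument: the \<open>n\<close>-th residue of the limit is that of
  \<open>S n\<close>.\<close>

lemma padic_int_complete:
  fixes S :: "nat \<Rightarrow> 'p::prime_card padic_int"
  assumes "\<And>n. of_nat CARD('p) ^ n dvd S (Suc n) - S n"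
  shows "\<exists>L. \<forall>n. of_nat CARD('p) ^ n dvd L - S n"
proof -
  define f where "f n = padic_residue (S n) n" for n
  have "0 \<le> f n \<and> f n < int CARD('p) ^ n \<and> f (Suc n) mod int CARD('p) ^ n = f n" for n
    using assms[of n] padic_residue_bounds[of "S n" n] padic_residue_mod[of n "Suc n" "S (Suc n)"]
    by (simp add: f_def padic_residue_eq_iff)
  then have "padic_residue (Abs_padic_int f :: 'p padic_int) = f"
    by (intro Abs_padic_int_inverse) blast
  then have "\<forall>n. of_nat CARD('p) ^ n dvd Abs_padic_int f - S n"
    by (simp add: padic_residue_eq_iff[symmetric] f_def)
  then show ?thesis ..
qed

lemma padic_LIMSEQ_I:
  fixes S :: "nat \<Rightarrow> 'p::prime_card padic_int"
  assumes "\<And>n. of_nat CARD('p) ^ n dvd L - S n"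
  shows "S \<longlonglongrightarrow> L"
proof -
  have p: "real CARD('p) > 1"
    using CARD_prime_card_gt_1[where 'p = 'p] by simp
  have bound: "dist (S n) L \<le> (1 / real CARD('p)) ^ n" for n
  proof (cases "S n = L")
    case False
    have "of_nat CARD('p) ^ n dvd S n - L"
      using assms[of n] dvd_minus_iff[of _ "L - S n"] by simp
    then have "n \<le> padic_val (S n - L)"
      using False by (simp add: CARD_power_dvd_iff_padic_val)
    then show ?thesis
      using False p unfolding dist_padic_int_def by (auto intro!: power_decreasing)
  qed simp
  have lim: "(\<lambda>n. (1 / real CARD('p)) ^ n) \<longlonglongrightarrow> 0"
    using p by (intro LIMSEQ_realpow_zero) auto
  have "(\<lambda>n. dist (S n) L) \<longlonglongrightarrow> 0"
    by (rule tendsto_sandwich[OF _ _ tendsto_const lim]) (use bound in auto)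
  then show ?thesis
    by (simp add: tendsto_dist_iff[of S L])
qed

text \<open>Convergence is proved on the way, so \<open>suminf\<close> is the genuine limit and may
  be replaced modulo \<open>p^n\<close> by its first \<open>n\<close> terms.\<close>

lemma padic_suminf_cong:
  fixes b :: "nat \<Rightarrow> 'p::prime_card padic_int"
  assumes "\<And>k. of_nat CARD('p) ^ k dvd b k"
  shows "of_nat CARD('p) ^ n dvd (\<Sum>k. b k) - (\<Sum>k<n. b k)"
proof -
  obtain L where L: "\<And>n. of_nat CARD('p) ^ n dvd L - (\<Sum>k<n. b k)"
    using padic_int_complete[of "\<lambda>n. \<Sum>k<n. b k"] assms by auto
  have "b sums L"
    unfolding sums_def using L by (rule padic_LIMSEQ_I)
  then show ?thesis
    using L sums_unique by blast
qed

text \<open>The first residue is the only candidate, so the definite description in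
  \<open>padic_rem\<close> is proper.\<close>

lemma padic_rem:
  fixes x :: "'p::prime_card padic_int"
  shows "padic_rem x \<in> {0..<int CARD('p)}" "of_nat CARD('p) dvd x - of_int (padic_rem x)"
proof -
  let ?P = "\<lambda>r. r \<in> {0..<int CARD('p)} \<and> of_nat CARD('p) dvd x - of_int r"
  have iff: "of_nat CARD('p) dvd x - of_int r \<longleftrightarrow> padic_residue x 1 = r"
    if "r \<in> {0..<int CARD('p)}" for r
  proof -
    have "(of_int r :: 'p padic_int) = of_nat (nat r)"
      using that by simp
    then have "padic_residue (of_int r :: 'p padic_int) 1 = r"
      using that by (simp only: padic_residue_of_nat) simp
    then show ?thesis
      using padic_residue_eq_iff[of x 1 "of_int r"] by simp
  qed
  have "padic_residue x 1 \<in> {0..<int CARD('p)}"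
    using padic_residue_bounds[of x 1] by simp
  then have "\<exists>!r. ?P r"
    using iff by blast
  then have "?P (padic_rem x)"
    unfolding padic_rem_def by (rule theI')
  then show "padic_rem x \<in> {0..<int CARD('p)}" "of_nat CARD('p) dvd x - of_int (padic_rem x)"
    by auto
qed

lemma not_is_unit_of_nat_CARD: "\<not> is_unit (of_nat CARD('p) :: 'p::prime_card padic_int)"
  using CARD_prime_card_gt_1[where 'p = 'p]
  by (simp add: of_nat_CARD_dvd_iff one_padic_int.rep_eq)

lemma of_nat_CARD_dvd_of_int_iff:
  "(of_nat CARD('p) :: 'p::prime_card padic_int) dvd of_int k \<longleftrightarrow> int CARD('p) dvd k"
proof
  assume "int CARD('p) dvd k"
  then show "(of_nat CARD('p) :: 'p padic_int) dvd of_int k"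
    using of_int_dvd_of_int[of "int CARD('p)" k, where 'a = "'p padic_int"] by simp
next
  assume dvd: "(of_nat CARD('p) :: 'p padic_int) dvd of_int k"
  show "int CARD('p) dvd k"
  proof (rule ccontr)
    assume "\<not> int CARD('p) dvd k"
    then have "coprime (int CARD('p)) k"
      using prime_card_int prime_imp_coprime by blast
    then obtain u v where "u * int CARD('p) + v * k = 1"
      by (metis bezout_int coprime_iff_gcd_eq_1)
    then have "(1 :: 'p padic_int) = of_int (u * int CARD('p) + v * k)"
      by simp
    also have "of_nat CARD('p) dvd \<dots>"
      using dvd by simp
    finally show False
      using not_is_unit_of_nat_CARD by blast
  qed
qed

text \<open>An inverse modulo \<open>p\<close> gives \<open>x * y = 1 - t\<close> with \<open>p\<close> dividing \<open>t\<close>; the geometric series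
  inverts the right-hand side.\<close>

lemma padic_is_unit_iff:
  fixes x :: "'p::prime_card padic_int"
  shows "is_unit x \<longleftrightarrow> \<not> of_nat CARD('p) dvd x"
proof
  assume "is_unit x"
  then show "\<not> of_nat CARD('p) dvd x"
    using not_is_unit_of_nat_CARD dvd_trans by blast
next
  let ?p = "of_nat CARD('p) :: 'p padic_int"
  assume nd: "\<not> ?p dvd x"
  define r where "r = padic_rem x"
  have xr: "?p dvd x - of_int r"
    unfolding r_def by (rule padic_rem)
  have "\<not> int CARD('p) dvd r"
    using xr nd dvd_add[of ?p "x - of_int r" "of_int r"] by (auto simp: of_nat_CARD_dvd_of_int_iff)
  then have "coprime (int CARD('p)) r"
    using prime_card_int prime_imp_coprime by blast
  then obtain u v where uv: "u * int CARD('p) + v * r = 1"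
    by (metis bezout_int coprime_iff_gcd_eq_1)
  define t where "t = 1 - x * of_int v"
  have "(1 :: 'p padic_int) = of_int (u * int CARD('p) + v * r)"
    using uv by simp
  then have "t = of_int u * ?p - (x - of_int r) * of_int v"
    unfolding t_def by (simp add: algebra_simps)
  then have t: "?p dvd t"
    using xr by simp
  define S where "S = (\<Sum>k. t ^ k)"
  have "?p ^ n dvd (1 - t) * S - 1" for n
  proof -
    have "?p ^ n dvd S - (\<Sum>k<n. t ^ k)"
      unfolding S_def using t by (intro padic_suminf_cong dvd_power_same)
    then have "?p ^ n dvd (1 - t) * (S - (\<Sum>k<n. t ^ k)) - t ^ n"
      using t by (intro dvd_diff[OF dvd_mult dvd_power_same])
    also have "(1 - t) * (S - (\<Sum>k<n. t ^ k)) - t ^ n = (1 - t) * S - 1"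
      using one_diff_power_eq[of t n] by (simp add: algebra_simps)
    finally show ?thesis .
  qed
  then have "(1 - t) * S - 1 = 0"
    by (simp add: padic_int_eq_0_iff CARD_power_dvd_iff)
  then have "1 = x * (of_int v * S)"
    by (simp add: t_def mult.assoc)
  then show "is_unit x"
    by (rule dvdI)
qed

text \<open>Fermat's little theorem holds for the integer remainder \<open>r\<close>, and
  \<open>w - r\<close> divides the difference of the powers.\<close>

lemma padic_fermat:
  fixes w :: "'p::prime_card padic_int"
  assumes "is_unit w"
  shows "of_nat CARD('p) dvd w ^ (CARD('p) - 1) - 1"
proof -
  let ?p = "of_nat CARD('p) :: 'p padic_int"
  let ?n = "CARD('p) - 1"
  define r where "r = nat (padic_rem w)"
  have r: "padic_rem w = int r"
    using padic_rem(1)[of w] by (simp add: r_def)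
  have wr: "?p dvd w - of_nat r"
    using padic_rem(2)[of w] by (simp add: r)
  have "\<not> CARD('p) dvd r"
  proof
    assume "CARD('p) dvd r"
    then have "?p dvd of_nat r"
      by (metis dvdE dvd_triv_left of_nat_mult)
    then have "?p dvd w"
      using wr dvd_add[of ?p "w - of_nat r" "of_nat r"] by simp
    then show False
      using assms padic_is_unit_iff by blast
  qed
  then have "[r ^ ?n = 1] (mod CARD('p))"
    using prime_card by (intro fermat_theorem)
  then have "[int (r ^ ?n) = int 1] (mod int CARD('p))"
    by (simp only: cong_int_iff)
  then have "?p dvd of_int (int (r ^ ?n) - int 1)"
    unfolding of_nat_CARD_dvd_of_int_iff by (simp add: cong_iff_dvd_diff)
  then have "?p dvd of_nat r ^ ?n - 1"
    by simp
  moreover have "?p dvd w ^ ?n - of_nat r ^ ?n"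
    using wr by (subst power_diff_sumr2) (rule dvd_mult2)
  ultimately show ?thesis
    using dvd_add[of ?p "w ^ ?n - of_nat r ^ ?n" "of_nat r ^ ?n - 1"] by simp
qed

text \<open>The terms of the series are divisible by \<open>p\<^sup>k\<close> whatever the value of \<^const>\<open>padic_binomial\<close>,
  so its integrality is not at stake.\<close>

lemma padic_power_cong:
  fixes w s :: "'p::prime_card padic_int"
  assumes "is_unit w"
  shows "of_nat CARD('p)^2 dvd
    padic_power w (int n, s) - w ^ n * (1 + s * (w ^ (CARD('p) - 1) - 1))"
proof -
  let ?b = "\<lambda>k. padic_binomial s k * (w ^ (CARD('p) - 1) - 1) ^ k"
  have "of_nat CARD('p)^2 dvd suminf ?b - (\<Sum>k<2. ?b k)"
    using padic_fermat[OF assms] by (intro padic_suminf_cong dvd_mult dvd_power_same)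
  also have "(\<Sum>k<2. ?b k) = 1 + s * (w ^ (CARD('p) - 1) - 1)"
    by (simp add: padic_binomial_def numeral_2_eq_2)
  finally have "of_nat CARD('p)^2 dvd
      w ^ n * (suminf ?b - (1 + s * (w ^ (CARD('p) - 1) - 1)))"
    by (rule dvd_mult)
  then show ?thesis
    by (simp add: padic_power_def right_diff_distrib)
qed

section \<open>Factorials and Pochhammer symbols\<close>

lemma is_unit_fact:
  assumes "k < CARD('p::prime_card)"
  shows "is_unit (fact k :: 'p padic_int)"
proof -
  have "\<not> CARD('p) dvd fact k"
    using assms prime_card[where 'a = 'p] by (simp add: prime_dvd_fact_iff)
  then have "\<not> int CARD('p) dvd int (fact k)"
    by (simp only: of_nat_dvd_iff not_False_eq_True)
  then show ?thesis
    using of_nat_CARD_dvd_of_int_iff[of "int (fact k)", where 'p = 'p] by (simp add: padic_is_unit_iff)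
qed

text \<open>For \<open>k < p\<close> the exact division is multiplication by one fixed element,
  which ring reasoning can handle.\<close>

lemma divide_fact:
  assumes "k < CARD('p::prime_card)"
  obtains v :: "'p::prime_card padic_int" where "\<And>x. x / fact k = x * v"
proof
  show "x / fact k = x * (1 / fact k)" for x :: "'p padic_int"
    using unit_div_mult_swap[OF is_unit_fact[OF assms], of x 1] by simp
qed

text \<open>Each Pochhammer symbol receives its own factorial, so that at integer parameters both
  quotients are binomial coefficients up to sign.\<close>

lemma hypergeom_2F1_trunc_eq:
  fixes \<alpha> \<beta> z :: "'p::prime_card padic_int"
  shows "hypergeom_2F1_trunc (CARD('p) - 1) \<alpha> \<beta> 1 z =
    (\<Sum>k<CARD('p). (pochhammer \<alpha> k / fact k) * (pochhammer \<beta> k / fact k) * z ^ k)"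
proof -
  have "{0..CARD('p) - 1} = {..<CARD('p)}"
    using CARD_prime_card_gt_1[where 'p = 'p] by auto
  moreover have "pochhammer \<alpha> k * pochhammer \<beta> k / pochhammer 1 k * (z ^ k / fact k) =
      (pochhammer \<alpha> k / fact k) * (pochhammer \<beta> k / fact k) * z ^ k" if k: "k < CARD('p)" for k
  proof -
    obtain v :: "'p padic_int" where "\<And>x. x / fact k = x * v"
      using divide_fact[OF k] by blast
    then show ?thesis
      by (simp add: pochhammer_fact[symmetric] mult_ac)
  qed
  ultimately show ?thesis
    unfolding hypergeom_2F1_trunc_def by (intro sum.cong) auto
qed

lemma pochhammer_minus_of_nat:
  "pochhammer (- of_nat N :: 'a::{comm_ring_1,semiring_char_0}) k = of_int ((-1) ^ k * int (N choose k)) * fact k"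
proof (induction k)
  case (Suc k)
  have "of_int ((-1) ^ Suc k * int (N choose Suc k)) * (fact (Suc k) :: 'a) =
      of_int ((-1) ^ Suc k * ((int k + 1) * int (N choose Suc k))) * fact k"
    by (simp add: mult_ac add_ac)
  also have "\<dots> = of_int ((-1) ^ k * int (N choose k)) * fact k * (- of_nat N + of_nat k)"
    unfolding choose_Suc_absorb by (simp add: algebra_simps)
  finally show ?case
    using Suc by (simp add: pochhammer_Suc)
qed simp

lemma pochhammer_of_nat_plus_1:
  "pochhammer (1 + of_nat N :: 'a::{comm_ring_1,semiring_char_0}) k = of_int (int ((N + k) choose k)) * fact k"
proof (induction k)
  case (Suc k)
  have "Suc k * ((N + Suc k) choose Suc k) = Suc (N + k) * ((N + k) choose k)"
    using Suc_times_binomial_eq[of "N + k" k] by (metis add_Suc_right mult.commute)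
  then have "(of_nat (Suc k * ((N + Suc k) choose Suc k)) :: 'a) = of_nat (Suc (N + k) * ((N + k) choose k))"
    by (rule arg_cong)
  then have "of_nat (Suc k) * of_nat ((N + Suc k) choose Suc k) =
      (of_nat (Suc (N + k)) * of_nat ((N + k) choose k) :: 'a)"
    by (simp only: of_nat_mult)
  then have "of_int (int ((N + Suc k) choose Suc k)) * (fact (Suc k) :: 'a) =
      of_nat (Suc (N + k)) * of_nat ((N + k) choose k) * fact k"
    by (simp only: fact_Suc of_int_of_nat_eq mult_ac)
  then show ?case
    using Suc by (simp add: pochhammer_Suc algebra_simps)
qed simp

section \<open>Reduction to two parameters\<close>

text \<open>The factor \<open>q\<close> in the slope makes this class closed under products: the
  quadratic term is a multiple of \<open>q^2\<close>.\<close>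

definition affine_mod_square :: "'a::comm_ring_1 \<Rightarrow> ('a \<Rightarrow> 'a) \<Rightarrow> bool" where
  "affine_mod_square q f \<longleftrightarrow> (\<exists>a b. \<forall>s. q^2 dvd f s - (a + q * b * s))"

lemma affine_mod_square_affine: "affine_mod_square q (\<lambda>s. a + q * b * s)"
  unfolding affine_mod_square_def by (rule exI[of _ a], rule exI[of _ b]) simp

lemma affine_mod_square_const: "affine_mod_square q (\<lambda>s. a)"
  using affine_mod_square_affine[of q a 0] by simp

lemma affine_mod_square_add:
  assumes "affine_mod_square q f" "affine_mod_square q g"
  shows "affine_mod_square q (\<lambda>s. f s + g s)"
proof -
  obtain a b c d where "\<And>s. q^2 dvd f s - (a + q * b * s)" "\<And>s. q^2 dvd g s - (c + q * d * s)"
    using assms unfolding affine_mod_square_def by blast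
  then have "q^2 dvd (f s - (a + q * b * s)) + (g s - (c + q * d * s))" for s
    by (rule dvd_add)
  moreover have "(f s - (a + q * b * s)) + (g s - (c + q * d * s)) =
      f s + g s - ((a + c) + q * (b + d) * s)" for s
    by (simp add: algebra_simps)
  ultimately show ?thesis
    unfolding affine_mod_square_def by metis
qed

lemma affine_mod_square_mult:
  assumes "affine_mod_square q f" "affine_mod_square q g"
  shows "affine_mod_square q (\<lambda>s. f s * g s)"
proof -
  obtain a b c d where f: "\<And>s. q^2 dvd f s - (a + q * b * s)" and g: "\<And>s. q^2 dvd g s - (c + q * d * s)"
    using assms unfolding affine_mod_square_def by blast
  have "q^2 dvd f s * g s - (a * c + q * (a * d + b * c) * s)" for s
  proof -
    have "q^2 dvd (f s - (a + q * b * s)) * g s + (a + q * b * s) * (g s - (c + q * d * s)) + q^2 * (b * d * s * s)"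
      using f g by (intro dvd_add dvd_mult dvd_mult2) auto
    also have "\<dots> = f s * g s - (a * c + q * (a * d + b * c) * s)"
      by (simp add: algebra_simps power2_eq_square)
    finally show ?thesis .
  qed
  then show ?thesis
    unfolding affine_mod_square_def by blast
qed

lemma affine_mod_square_diff:
  assumes "affine_mod_square q f" "affine_mod_square q g"
  shows "affine_mod_square q (\<lambda>s. f s - g s)"
  using affine_mod_square_add[OF assms(1) affine_mod_square_mult[OF affine_mod_square_const[of q "-1"] assms(2)]]
  by simp

lemma affine_mod_square_sum:
  assumes "\<And>i. i \<in> A \<Longrightarrow> affine_mod_square q (f i)"
  shows "affine_mod_square q (\<lambda>s. \<Sum>i\<in>A. f i s)"
  using assms
  by (induction A rule: infinite_finite_induct)
    (simp_all add: affine_mod_square_const affine_mod_square_add)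

lemma affine_mod_square_prod:
  assumes "\<And>i. i \<in> A \<Longrightarrow> affine_mod_square q (f i)"
  shows "affine_mod_square q (\<lambda>s. \<Prod>i\<in>A. f i s)"
  using assms
  by (induction A rule: infinite_finite_induct)
    (simp_all add: affine_mod_square_const affine_mod_square_mult)

lemma affine_mod_square_pochhammer:
  assumes "affine_mod_square q f"
  shows "affine_mod_square q (\<lambda>s. pochhammer (f s) k)"
  unfolding pochhammer_prod
  by (intro affine_mod_square_prod affine_mod_square_add affine_mod_square_const assms)

text \<open>The value at 0 controls the constant term \<open>a\<close>, and the value at -1 then
  controls the whole slope \<open>q * b\<close>.\<close>

lemma affine_mod_square_eq_0:
  assumes "affine_mod_square q f" "q^2 dvd f 0" "q^2 dvd f (-1)"
  shows "q^2 dvd f s"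
proof -
  obtain a b where ab: "\<And>s. q^2 dvd f s - (a + q * b * s)"
    using assms(1) unfolding affine_mod_square_def by blast
  have a: "q^2 dvd a"
    using dvd_diff[OF assms(2) ab[of 0]] by simp
  have "q^2 dvd a - (f (-1) - (f (-1) - (a + q * b * (-1))))"
    by (intro dvd_diff[OF a dvd_diff[OF assms(3) ab]])
  then have "q^2 dvd q * b"
    by simp
  then have "q^2 dvd (f s - (a + q * b * s)) + (a + q * b * s)"
    by (intro dvd_add[OF ab dvd_add[OF a dvd_mult2]])
  then show ?thesis
    by simp
qed

lemma affine_mod_square_hypergeom:
  fixes f g :: "'p::prime_card padic_int \<Rightarrow> 'p padic_int"
  assumes "affine_mod_square q f" "affine_mod_square q g"
  shows "affine_mod_square q (\<lambda>s. hypergeom_2F1_trunc (CARD('p) - 1) (f s) (g s) 1 z)"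
  unfolding hypergeom_2F1_trunc_eq
proof (intro affine_mod_square_sum affine_mod_square_mult[OF _ affine_mod_square_const])
  fix k assume "k \<in> {..<CARD('p)}"
  then obtain v :: "'p padic_int" where "\<And>x. x / fact k = x * v"
    using divide_fact[of k] by blast
  then show "affine_mod_square q (\<lambda>s. pochhammer (f s) k / fact k * (pochhammer (g s) k / fact k))"
    by (simp only:) (intro affine_mod_square_mult affine_mod_square_pochhammer affine_mod_square_const assms)
qed

section \<open>The series at \<open>\<alpha> = - N\<close> for a natural number
  \<open>N\<close>\<close>

lemma hypergeom_minus_of_nat:
  fixes z :: "'p::prime_card padic_int"
  shows "hypergeom_2F1_trunc (CARD('p) - 1) (- of_nat N) (- of_nat N) 1 z =
    (\<Sum>k<CARD('p). of_nat (N choose k)^2 * z ^ k)"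
  unfolding hypergeom_2F1_trunc_eq pochhammer_minus_of_nat
  by (intro sum.cong) (simp_all add: power2_eq_square flip: mult.assoc power_add)

lemma hypergeom_legendre:
  fixes x :: "'p::prime_card padic_int"
  shows "hypergeom_2F1_trunc (CARD('p) - 1) (- of_nat N) (1 - (- of_nat N)) 1 x =
    (\<Sum>k<CARD('p). of_int (legendre_coeff N k) * x ^ k)"
proof -
  have "1 - (- of_nat N) = (1 + of_nat N :: 'p padic_int)"
    by simp
  then show ?thesis
    unfolding hypergeom_2F1_trunc_eq legendre_coeff_def
    by (simp only: pochhammer_minus_of_nat pochhammer_of_nat_plus_1) simp
qed

text \<open>The hypothesis is \<open>x = z / (z - 1)\<close> without division: a factor
  \<open>(1 - z) ^ k\<close> of the prefactor turns \<open>x ^ k\<close> into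
  \<open>(- z) ^ k\<close>. For \<open>k > N\<close>, where \<open>N - k\<close> is cut off at 0,
  the coefficient vanishes.\<close>

lemma legendre_sum_pfaff:
  fixes x z :: "'a::comm_ring_1"
  assumes "(1 - z) * x = - z"
  shows "(1 - z) ^ N * (\<Sum>k<n. of_int (legendre_coeff N k) * x ^ k) =
    (\<Sum>k<n. (-1) ^ k * of_int (legendre_coeff N k) * z ^ k * (1 - z) ^ (N - k))"
  unfolding sum_distrib_left
proof (rule sum.cong)
  fix k
  show "(1 - z) ^ N * (of_int (legendre_coeff N k) * x ^ k) =
    (-1) ^ k * of_int (legendre_coeff N k) * z ^ k * (1 - z) ^ (N - k)"
  proof (cases "k \<le> N")
    case True
    then have "(1 - z) ^ N * x ^ k = (1 - z) ^ (N - k) * ((1 - z) * x) ^ k"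
      by (simp add: power_mult_distrib flip: mult.assoc power_add)
    also have "\<dots> = (1 - z) ^ (N - k) * ((-1) ^ k * z ^ k)"
      unfolding assms by (simp add: power_minus[of z])
    finally have *: "(1 - z) ^ N * x ^ k = (1 - z) ^ (N - k) * ((-1) ^ k * z ^ k)" .
    show ?thesis
      unfolding mult.left_commute[of "(1 - z) ^ N"] * by (simp only: mult_ac)
  qed (simp add: legendre_coeff_def binomial_eq_0)
qed simp

lemma sum_choose_squares_inverse:
  fixes y z :: "'a::comm_ring_1"
  assumes "z * y = 1"
  shows "z ^ N * (\<Sum>k<n. of_nat (N choose k)^2 * y ^ k) =
    (\<Sum>k<n. of_nat (N choose k)^2 * z ^ (N - k))"
  unfolding sum_distrib_left
proof (rule sum.cong)
  fix k
  show "z ^ N * (of_nat (N choose k)^2 * y ^ k) = of_nat (N choose k)^2 * z ^ (N - k)"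
  proof (cases "k \<le> N")
    case True
    then have *: "z ^ N * y ^ k = z ^ (N - k) * (z * y) ^ k"
      by (simp add: power_mult_distrib flip: mult.assoc power_add)
    show ?thesis
      unfolding mult.left_commute[of "z ^ N"] * assms by simp
  qed (simp add: binomial_eq_0)
qed simp

lemma sum_choose_squares_palindromic:
  fixes z :: "'a::comm_ring_1"
  assumes "a < n"
  shows "(\<Sum>k<n. of_nat (a choose k)^2 * z ^ (a - k)) = (\<Sum>k<n. of_nat (a choose k)^2 * z ^ k)"
proof -
  have "(\<Sum>k<n. of_nat (a choose k)^2 * z ^ (a - k)) = (\<Sum>k\<le>a. of_nat (a choose k)^2 * z ^ (a - k))"
    using assms by (intro sum.mono_neutral_right) (auto simp: binomial_eq_0)
  also have "\<dots> = (\<Sum>k\<le>a. of_nat (a choose k)^2 * z ^ k)"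
    by (rule sum.reindex_bij_witness[of _ "\<lambda>k. a - k" "\<lambda>k. a - k"])
      (auto simp: binomial_symmetric[symmetric])
  also have "\<dots> = (\<Sum>k<n. of_nat (a choose k)^2 * z ^ k)"
    using assms by (intro sum.mono_neutral_left) (auto simp: binomial_eq_0)
  finally show ?thesis .
qed

theorem theorem2p3:
  fixes p :: nat and \<alpha> z :: "'p::prime_card padic_int"
  assumes "p = CARD('p)" and "prime p" and "odd p"
    and "is_unit z"
    and "coprime (z - 1) (of_nat p)"
  shows "padic_cong (of_nat p ^ 2)
    (hypergeom_2F1_trunc (p - 1) \<alpha> \<alpha> 1 z
      - padic_power z ((1, 0) - padic_lambda \<alpha>) * hypergeom_2F1_trunc (p - 1) \<alpha> \<alpha> 1 (1 / z))
    (padic_power (1 - z) ((1, 0) - padic_lambda \<alpha>)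
      * hypergeom_2F1_trunc (p - 1) \<alpha> (1 - \<alpha>) 1 (z / (z - 1)))"
proof -
  let ?p = "of_nat p :: 'p padic_int"
  have "\<not> ?p dvd z - 1"
    using assms(5) not_is_unit_of_nat_CARD[where 'p = 'p] unfolding assms(1)
    by (metis coprime_common_divisor dvd_refl)
  then have unit': "is_unit (z - 1)"
    by (simp add: padic_is_unit_iff assms(1))
  then have unit: "is_unit (1 - z)"
    using minus_dvd_iff[of "z - 1" 1] by simp
  define x y where "x = z / (z - 1)" and "y = 1 / z"
  have y: "z * y = 1"
    using assms(4) by (simp add: y_def)
  have "(z - 1) * x = z"
    unfolding x_def by (rule dvd_mult_div_cancel[OF unit_imp_dvd[OF unit']])
  then have x: "(1 - z) * x = - z"
    by (simp add: algebra_simps)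
  define a where "a = nat (padic_rem (- \<alpha>))"
  have a: "padic_rem (- \<alpha>) = int a" "a < p"
    using padic_rem(1)[of "- \<alpha>"] by (auto simp: a_def assms(1))
  define s where "s = (\<alpha> + of_nat a) / ?p"
  have "?p dvd - \<alpha> - of_nat a"
    using padic_rem(2)[of "- \<alpha>"] by (simp add: a assms(1))
  then have "?p dvd \<alpha> + of_nat a"
    using dvd_minus_iff[of ?p "\<alpha> + of_nat a"] by simp
  then have \<alpha>: "\<alpha> = - of_nat a + ?p * s"
    by (simp add: s_def)
  \<comment> \<open>The first component is positive, so \<open>powi\<close> is an ordinary power and
    \<open>padic_power_cong\<close> applies.\<close>
  have exponent: "(1, 0) - padic_lambda \<alpha> = (int (Suc a), - s)"
    by (simp add: padic_lambda_def a s_def assms(1))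
  define q where "q w = (w ^ (p - 1) - 1 :: 'p padic_int)" for w
  \<comment> \<open>Modulo \<open>p^2\<close> this is the power of \<open>w\<close> in the theorem,
    with \<open>s\<close> freed to a variable \<open>t\<close>.\<close>
  define e where "e w t = w ^ Suc a * (1 - t * q w)" for w t
  define F where "F w t = hypergeom_2F1_trunc (p - 1) (- of_nat a + ?p * t) (- of_nat a + ?p * t) 1 w" for w t
  define G where "G t = hypergeom_2F1_trunc (p - 1) (- of_nat a + ?p * t) (1 - (- of_nat a + ?p * t)) 1 x" for t
  \<comment> \<open>The difference of the two sides as a function of \<open>t\<close>; \<alpha>
    itself corresponds to \<open>t = s\<close>.\<close>
  define D where "D t = F z t - e z t * F y t - e (1 - z) t * G t" for t
  have power: "?p^2 dvd padic_power w ((1, 0) - padic_lambda \<alpha>) - e w s" if "is_unit w" for w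
    using padic_power_cong[OF that, of "Suc a" "- s"] unfolding exponent e_def q_def assms(1) by simp
  have "affine_mod_square ?p D"
  proof -
    have lin: "affine_mod_square ?p (\<lambda>t. - of_nat a + ?p * t)"
      using affine_mod_square_affine[of ?p "- of_nat a" 1] by simp
    have "affine_mod_square ?p (\<lambda>t. F w t)" for w
      unfolding F_def assms(1) by (intro affine_mod_square_hypergeom lin[unfolded assms(1)])
    moreover have "affine_mod_square ?p G"
      unfolding G_def assms(1)
      by (intro affine_mod_square_hypergeom affine_mod_square_diff affine_mod_square_const lin[unfolded assms(1)])
    moreover have "affine_mod_square ?p (e w)" if w: "is_unit w" for w
    proof -
      \<comment> \<open>Fermat supplies the factor \<open>p\<close> that the slope of
        \<open>e w\<close> must have.\<close>
      obtain c where "q w = ?p * c"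
        using padic_fermat[OF w] unfolding q_def assms(1) by (elim dvdE)
      then have "e w = (\<lambda>t. w ^ Suc a * (1 + ?p * (- c) * t))"
        by (simp add: e_def fun_eq_iff)
      then show ?thesis
        by (simp only:) (intro affine_mod_square_mult affine_mod_square_const affine_mod_square_affine)
    qed
    ultimately show ?thesis
      unfolding D_def using assms(4) unit by (intro affine_mod_square_diff affine_mod_square_mult)
  qed
  moreover have "?p^2 dvd D 0"
  proof -
    let ?F = "\<Sum>k<p. of_nat (a choose k)^2 * z ^ k"
    have "F z 0 = ?F"
      using hypergeom_minus_of_nat[of a z] by (simp add: F_def assms(1))
    moreover have "e z 0 * F y 0 = z * ?F"
    proof -
      have "z ^ a * F y 0 = ?F"
        using hypergeom_minus_of_nat[of a y] sum_choose_squares_inverse[OF y, of a p]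
          sum_choose_squares_palindromic[OF a(2), of z] by (simp add: F_def assms(1))
      then show ?thesis
        by (simp add: e_def mult.assoc)
    qed
    moreover have "e (1 - z) 0 * G 0 = (1 - z) * ?F"
    proof -
      have "(1 - z) ^ a * G 0 = ?F"
        using hypergeom_legendre[of a x] legendre_sum_pfaff[OF x, of a p]
          pfaff_choose_squares[OF a(2), of z] by (simp add: G_def assms(1))
      then show ?thesis
        by (simp add: e_def mult.assoc)
    qed
    \<comment> \<open>All three terms are multiples of the same sum, with factors \<open>1\<close>,
      \<open>z\<close> and \<open>1 - z\<close>, so they cancel exactly.\<close>
    ultimately have "D 0 = 0"
      by (simp add: D_def algebra_simps)
    then show ?thesis
      by simp
  qed
  moreover have "?p^2 dvd D (-1)"
  proof -
    let ?N = "p + a"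
    \<comment> \<open>At \<open>t = -1\<close> the bracket \<open>1 + (w ^ (p - 1) - 1)\<close>
      collapses, so the approximate power is an honest one with exponent
      \<open>p + a\<close>.\<close>
    have e: "e w (-1) = w ^ ?N" for w
    proof -
      have "e w (-1) = w ^ (Suc a + (p - 1))"
        by (simp add: e_def q_def power_add)
      then show ?thesis
        using a(2) by (simp add: add.commute)
    qed
    have \<alpha>': "- of_nat a + ?p * (-1) = - of_nat ?N"
      by simp
    have F: "F w (-1) = (\<Sum>k<p. of_nat (?N choose k)^2 * w ^ k)" for w
      unfolding F_def \<alpha>' using hypergeom_minus_of_nat[of ?N w] by (simp only: assms(1))
    have G: "G (-1) = (\<Sum>k<p. of_int (legendre_coeff ?N k) * x ^ k)"
      unfolding G_def \<alpha>' using hypergeom_legendre[of ?N x] by (simp only: assms(1))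
    have "D (-1) = - ((\<Sum>k<p. (-1) ^ k * of_int (legendre_coeff ?N k) * z ^ k * (1 - z) ^ (?N - k))
        - ((\<Sum>k<p. of_nat (?N choose k)^2 * z ^ k) - (\<Sum>k<p. of_nat (?N choose k)^2 * z ^ (?N - k))))"
      unfolding D_def e F G sum_choose_squares_inverse[OF y] legendre_sum_pfaff[OF x] minus_diff_eq ..
    then show ?thesis
      using pfaff_choose_squares_prime[OF assms(2,3) a(2), of z] by (simp only: dvd_minus_iff)
  qed
  ultimately have "?p^2 dvd D s"
    by (rule affine_mod_square_eq_0)
  \<comment> \<open>Exchange the approximations \<open>e\<close> for the actual powers, at the cost
    of multiples of \<open>p^2\<close>.\<close>
  then have "?p^2 dvd D s - (padic_power z ((1, 0) - padic_lambda \<alpha>) - e z s) * F y s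
      - (padic_power (1 - z) ((1, 0) - padic_lambda \<alpha>) - e (1 - z) s) * G s"
    by (rule dvd_diff[OF dvd_diff[OF _ dvd_mult2[OF power[OF assms(4)]]] dvd_mult2[OF power[OF unit]]])
  also have "\<dots> = F z s - padic_power z ((1, 0) - padic_lambda \<alpha>) * F y s
      - padic_power (1 - z) ((1, 0) - padic_lambda \<alpha>) * G s"
    by (simp add: D_def algebra_simps)
  finally show ?thesis
    unfolding padic_cong_def F_def G_def \<alpha>[symmetric] x_def y_def .
qed

end
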